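(* Let $f\in\mathbb{R}[x_1,\ldots,x_n]$ be a form (homogeneous polynomial) of degree $d\ge1$. Then: (i) Every local minimum $f^*$ of $f$ on $\mathcal{E}_n$ satisfies $f^*\le0$. If $f^*<0$ then it is attained at some (local minimizer) $\mathbf{x}^*\in\mathbb{S}^{n-1}$, and so $f^*$ is also a local minimum of $f$ on $\mathbb{S}^{n-1}$. If $f^*=0$ then either $f^*$ is attained (as a local minimum on $\mathcal{E}_n$) only at $\mathbf{x}^*=0$, or $f^*$ is also a local minimum (also attained) on $\mathbb{S}^{n-1}$. (ii) Every local minimum $f^*\le0$ of $f$ on $\mathbb{S}^{n-1}$ is also a local minimum of $f$ on $\mathcal{E}_n$.
   Context: $\mathbb{S}^{n-1}$ is the Euclidean unit sphere and $\mathcal{E}_n=\{\mathbf{x}:\|\mathbf{x}\|\le1\}$ the Euclidean unit ball in $\mathbb{R}^n$. For $K\in\{\mathbb{S}^{n-1},\mathcal{E}_n\}$, a point $\mathbf{x}^*\in K$ is a local minimizer of $f$ on $K$ (and the value $f(\mathbf{x}^* )$ is a local minimum on $K$, attained at $\mathbf{x}^*$) if there is $\varepsilon>0$ such that $f(\mathbf{x}^* )\le f(\mathbf{x})$ for all $\mathbf{x}\in K$ with $\|\mathbf{x}-\mathbf{x}^*\|<\varepsilon$. *)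

theory Defs
  imports "HOL-Analysis.Analysis" "HOL-Library.Poly_Mapping"
begin

text \<open>
  A polynomial in \<open>\<real>[x\<^sub>i | i \<in> 'n]\<close> is a finitely supported map from monomials to
  coefficients; a monomial is in turn a finitely supported map from variables to exponents.
  The dimension is \<open>n = CARD('n)\<close>.
\<close>
type_synonym 'n real_mpoly = "('n \<Rightarrow>\<^sub>0 nat) \<Rightarrow>\<^sub>0 real"

definition eval_mpoly :: "'n::finite real_mpoly \<Rightarrow> real ^ 'n \<Rightarrow> real" where
  "eval_mpoly p x =
    (\<Sum>m \<in> Poly_Mapping.keys p. Poly_Mapping.lookup p m * (\<Prod>i\<in>UNIV. (x $ i) ^ Poly_Mapping.lookup m i))"

text \<open>The zero polynomial counts as a form of every degree.\<close>
definition is_form :: "nat \<Rightarrow> 'n::finite real_mpoly \<Rightarrow> bool" where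
  "is_form d p \<longleftrightarrow> (\<forall>m \<in> Poly_Mapping.keys p. (\<Sum>i\<in>UNIV. Poly_Mapping.lookup m i) = d)"

definition local_minimizer_on :: "('a::real_normed_vector \<Rightarrow> real) \<Rightarrow> 'a set \<Rightarrow> 'a \<Rightarrow> bool" where
  "local_minimizer_on f K x \<longleftrightarrow>
    x \<in> K \<and> (\<exists>\<epsilon>>0. \<forall>y\<in>K. norm (y - x) < \<epsilon> \<longrightarrow> f x \<le> f y)"

text \<open>A local minimum is a value, as opposed to the point at which it is attained.\<close>
definition local_minimum_on :: "('a::real_normed_vector \<Rightarrow> real) \<Rightarrow> 'a set \<Rightarrow> real \<Rightarrow> bool" where
  "local_minimum_on f K v \<longleftrightarrow> (\<exists>x. local_minimizer_on f K x \<and> f x = v)"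

end

theory Submission imports Defs begin

text \<open>
  Everything follows from the identity \<open>f (t x) = t\<^sup>d f x\<close> for \<open>t \<ge> 0\<close>: along each ray
  from the origin \<open>f\<close> is a multiple of \<open>t\<^sup>d\<close>.

  A positive value can therefore be lowered by moving towards the origin, which never leaves the
  ball, and a negative value by moving outwards, which is possible as long as the point is not on
  the sphere. Hence local minima on the ball are nonpositive
  (\<open>local_minimizer_cball_nonpos\<close>), and negative ones are attained on the sphere only
  (\<open>local_minimizer_cball_neg_in_sphere\<close>). A zero of \<open>f\<close> gives no such constraint, but scaling
  preserves the sign of \<open>f\<close>, so a local minimizer \<open>x \<noteq> 0\<close> with value \<open>0\<close> can be projected to
  \<open>x / \<parallel>x\<parallel>\<close> on the sphere (\<open>local_minimizer_sphere_sgn\<close>).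

  Conversely, a point \<open>z\<close> of the ball near a local minimizer \<open>x\<close> on the sphere is \<open>\<parallel>z\<parallel> y\<close> with \<open>y\<close>
  on the sphere near \<open>x\<close>, so \<open>f z = \<parallel>z\<parallel>\<^sup>d f y \<ge> \<parallel>z\<parallel>\<^sup>d f x\<close>, and the last term is at least
  \<open>f x\<close> because \<open>f x \<le> 0\<close> and \<open>\<parallel>z\<parallel> \<le> 1\<close>
  (\<open>local_minimizer_sphere_imp_cball\<close>).
\<close>

definition pos_homogeneous :: "nat \<Rightarrow> ('a::real_normed_vector \<Rightarrow> real) \<Rightarrow> bool" where
  "pos_homogeneous d f \<longleftrightarrow> (\<forall>t\<ge>0. \<forall>x. f (t *\<^sub>R x) = t ^ d * f x)"

lemma pos_homogeneousD:
  "pos_homogeneous d f \<Longrightarrow> t \<ge> 0 \<Longrightarrow> f (t *\<^sub>R x) = t ^ d * f x"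
  unfolding pos_homogeneous_def by blast

lemma pos_homogeneous_eval_mpoly:
  fixes p :: "'n::finite real_mpoly"
  assumes "is_form d p"
  shows "pos_homogeneous d (eval_mpoly p)"
proof -
  have "eval_mpoly p (t *\<^sub>R x) = t ^ d * eval_mpoly p x" for t x
  proof -
    have monomial: "(\<Prod>i\<in>UNIV. ((t *\<^sub>R x) $ i) ^ Poly_Mapping.lookup m i)
          = t ^ d * (\<Prod>i\<in>UNIV. (x $ i) ^ Poly_Mapping.lookup m i)"
      if "m \<in> Poly_Mapping.keys p" for m
      using assms that
      by (simp add: is_form_def power_mult_distrib prod.distrib flip: power_sum)
    show ?thesis
      unfolding eval_mpoly_def sum_distrib_left
      by (intro sum.cong refl) (simp only: monomial mult.left_commute)
  qed
  then show ?thesis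
    unfolding pos_homogeneous_def by blast
qed

lemma local_minimizer_on_subset:
  "local_minimizer_on f K x \<Longrightarrow> L \<subseteq> K \<Longrightarrow> x \<in> L \<Longrightarrow> local_minimizer_on f L x"
  unfolding local_minimizer_on_def by blast

text \<open>
  Testing minimality only against points of the same ray turns it into a one-variable inequality
  for \<open>t \<mapsto> t\<^sup>d f x\<close> near \<open>t = 1\<close>.
\<close>
lemma local_minimizer_cball_radial:
  assumes hom: "pos_homogeneous d f" and min: "local_minimizer_on f (cball 0 1) x"
  obtains \<epsilon> where "\<epsilon> > 0"
    and "\<And>t. t \<ge> 0 \<Longrightarrow> \<bar>t - 1\<bar> < \<epsilon> \<Longrightarrow> t * norm x \<le> 1 \<Longrightarrow> f x \<le> t ^ d * f x"
proof -
  from min obtain \<epsilon> where "\<epsilon> > 0" and x: "norm x \<le> 1"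
    and le: "\<And>y. norm y \<le> 1 \<Longrightarrow> norm (y - x) < \<epsilon> \<Longrightarrow> f x \<le> f y"
    unfolding local_minimizer_on_def by auto
  have "f x \<le> t ^ d * f x" if t: "t \<ge> 0" "\<bar>t - 1\<bar> < \<epsilon>" "t * norm x \<le> 1" for t
  proof -
    have "norm (t *\<^sub>R x - x) = \<bar>t - 1\<bar> * norm x"
      by (metis norm_scaleR scaleR_left_diff_distrib scaleR_one)
    also have "\<dots> \<le> \<bar>t - 1\<bar>"
      using x by (simp add: mult_left_le)
    finally have "f x \<le> f (t *\<^sub>R x)"
      using t by (intro le) auto
    then show ?thesis
      using t by (simp add: pos_homogeneousD[OF hom])
  qed
  with \<open>\<epsilon> > 0\<close> show ?thesis
    using that by blast
qed

lemma local_minimizer_cball_nonpos: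
  assumes "d \<ge> 1" "pos_homogeneous d f" "local_minimizer_on f (cball 0 1) x"
  shows "f x \<le> 0"
proof (rule ccontr)
  assume "\<not> f x \<le> 0"
  obtain \<epsilon> where "\<epsilon> > 0"
    and le: "\<And>t. t \<ge> 0 \<Longrightarrow> \<bar>t - 1\<bar> < \<epsilon> \<Longrightarrow> t * norm x \<le> 1 \<Longrightarrow> f x \<le> t ^ d * f x"
    using local_minimizer_cball_radial[OF assms(2,3)] by blast
  define t where "t = 1 - min (\<epsilon> / 2) 1"
  have t: "t \<ge> 0" "t < 1" "\<bar>t - 1\<bar> < \<epsilon>"
    using \<open>\<epsilon> > 0\<close> unfolding t_def by linarith+
  have "norm x \<le> 1"
    using assms(3) by (simp add: local_minimizer_on_def)
  with t have "t * norm x \<le> 1"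
    by (intro mult_le_one) auto
  with t have "f x \<le> t ^ d * f x"
    by (intro le)
  moreover have "t ^ d < 1"
    using t \<open>d \<ge> 1\<close> by (simp add: power_less_one_iff)
  ultimately show False
    using \<open>\<not> f x \<le> 0\<close> by simp
qed

lemma local_minimizer_cball_neg_in_sphere:
  assumes "d \<ge> 1" "pos_homogeneous d f" "local_minimizer_on f (cball 0 1) x" "f x < 0"
  shows "x \<in> sphere 0 1"
proof (rule ccontr)
  assume "x \<notin> sphere 0 1"
  then have x: "norm x < 1"
    using assms(3) by (simp add: local_minimizer_on_def)
  obtain \<epsilon> where "\<epsilon> > 0"
    and le: "\<And>t. t \<ge> 0 \<Longrightarrow> \<bar>t - 1\<bar> < \<epsilon> \<Longrightarrow> t * norm x \<le> 1 \<Longrightarrow> f x \<le> t ^ d * f x"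
    using local_minimizer_cball_radial[OF assms(2,3)] by blast
  \<comment> \<open>With \<open>s \<le> 1 - \<parallel>x\<parallel>\<close>, the stretched vector has norm at most \<open>\<parallel>x\<parallel> + s \<le> 1\<close>.\<close>
  define s where "s = min (\<epsilon> / 2) (1 - norm x)"
  have s: "s > 0" "s < \<epsilon>" "s \<le> 1 - norm x"
    using \<open>\<epsilon> > 0\<close> x unfolding s_def by linarith+
  have "s * norm x \<le> s"
    using s(1) x by (simp add: mult_left_le)
  then have "(1 + s) * norm x \<le> 1"
    using s(3) by (simp add: distrib_right)
  with s have "f x \<le> (1 + s) ^ d * f x"
    by (intro le) auto
  moreover have "(1 + s) ^ d > 1"
    using s \<open>d \<ge> 1\<close> by (intro one_less_power) auto
  ultimately show False
    using \<open>f x < 0\<close> by simp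
qed

text \<open>
  Scaling by \<open>\<parallel>x\<parallel> \<le> 1\<close> carries the sphere near \<open>x / \<parallel>x\<parallel>\<close> into the ball near \<open>x\<close>, where \<open>f\<close> is
  nonnegative, and it preserves the sign of \<open>f\<close>.
\<close>
lemma local_minimizer_sphere_sgn:
  assumes hom: "pos_homogeneous d f" and min: "local_minimizer_on f (cball 0 1) x"
    and "x \<noteq> 0" "f x = 0"
  shows "local_minimizer_on f (sphere 0 1) (sgn x)" and "f (sgn x) = 0"
proof -
  show sgn: "f (sgn x) = 0"
    using pos_homogeneousD[OF hom, of "inverse (norm x)" x] \<open>f x = 0\<close> by (simp add: sgn_div_norm)
  from min \<open>f x = 0\<close> obtain \<epsilon> where "\<epsilon> > 0" and x: "norm x \<le> 1"
    and le: "\<And>y. norm y \<le> 1 \<Longrightarrow> norm (y - x) < \<epsilon> \<Longrightarrow> 0 \<le> f y"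
    unfolding local_minimizer_on_def by auto
  have "0 \<le> f y" if y: "norm y = 1" "norm (y - sgn x) < \<epsilon>" for y
  proof -
    have "norm x *\<^sub>R y - x = norm x *\<^sub>R (y - sgn x)"
      using \<open>x \<noteq> 0\<close> by (simp add: sgn_div_norm scaleR_diff_right)
    then have "norm (norm x *\<^sub>R y - x) = norm x * norm (y - sgn x)"
      by simp
    also have "\<dots> \<le> norm (y - sgn x)"
      using x by (simp add: mult_left_le_one_le)
    finally have "0 \<le> f (norm x *\<^sub>R y)"
      using x y by (intro le) auto
    then have "0 \<le> norm x ^ d * f y"
      by (simp add: pos_homogeneousD[OF hom])
    moreover have "norm x ^ d > 0"
      using \<open>x \<noteq> 0\<close> by simp
    ultimately show ?thesis
      by (simp add: zero_le_mult_iff)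
  qed
  with \<open>\<epsilon> > 0\<close> \<open>x \<noteq> 0\<close> sgn show "local_minimizer_on f (sphere 0 1) (sgn x)"
    unfolding local_minimizer_on_def by (auto simp: norm_sgn)
qed

lemma norm_sgn_diff_le:
  fixes x z :: "'a::real_normed_vector"
  assumes "norm x = 1" "z \<noteq> 0"
  shows "norm (sgn z - x) \<le> 2 * norm (z - x)"
proof -
  have "sgn z - z = (1 - norm z) *\<^sub>R sgn z"
    using \<open>z \<noteq> 0\<close> by (simp add: sgn_div_norm algebra_simps)
  then have "norm (sgn z - z) = \<bar>norm x - norm z\<bar>"
    using assms by (simp add: norm_sgn)
  also have "\<dots> \<le> norm (z - x)"
    by (metis norm_minus_commute norm_triangle_ineq3)
  finally show ?thesis
    using norm_triangle_ineq[of "sgn z - z" "z - x"] by simp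
qed

lemma local_minimizer_sphere_imp_cball:
  assumes hom: "pos_homogeneous d f" and min: "local_minimizer_on f (sphere 0 1) x"
    and "f x \<le> 0"
  shows "local_minimizer_on f (cball 0 1) x"
proof -
  from min obtain \<epsilon> where "\<epsilon> > 0" and x: "norm x = 1"
    and le: "\<And>y. norm y = 1 \<Longrightarrow> norm (y - x) < \<epsilon> \<Longrightarrow> f x \<le> f y"
    unfolding local_minimizer_on_def by auto
  \<comment> \<open>The bound \<open>1\<close> keeps \<open>z\<close> away from the origin, the factor \<open>2\<close> is that of \<open>norm_sgn_diff_le\<close>.\<close>
  define \<delta> where "\<delta> = min (\<epsilon> / 2) 1"
  have "f x \<le> f z" if z: "norm z \<le> 1" "norm (z - x) < \<delta>" for z
  proof -
    have "z \<noteq> 0"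
      using z x by (auto simp: \<delta>_def)
    have "norm (sgn z - x) < \<epsilon>"
      using norm_sgn_diff_le[OF x \<open>z \<noteq> 0\<close>] z by (simp add: \<delta>_def)
    then have "f x \<le> f (sgn z)"
      using \<open>z \<noteq> 0\<close> by (intro le) (simp_all add: norm_sgn)
    have "norm z ^ d \<le> 1"
      using z by (simp add: power_le_one)
    then have "f x \<le> norm z ^ d * f x"
      using mult_right_mono_neg[OF _ \<open>f x \<le> 0\<close>, of "norm z ^ d" 1] by simp
    also have "\<dots> \<le> norm z ^ d * f (sgn z)"
      using \<open>f x \<le> f (sgn z)\<close> by (simp add: mult_left_mono)
    also have "\<dots> = f (norm z *\<^sub>R sgn z)"
      by (simp add: pos_homogeneousD[OF hom])
    also have "\<dots> = f z"
      using \<open>z \<noteq> 0\<close> by (simp add: sgn_div_norm)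
    finally show ?thesis .
  qed
  moreover have "\<delta> > 0"
    using \<open>\<epsilon> > 0\<close> by (simp add: \<delta>_def)
  ultimately show ?thesis
    using x unfolding local_minimizer_on_def by auto
qed

theorem lemma2p6:
  fixes p :: "'n::finite real_mpoly" and d :: nat and f :: "real ^ 'n \<Rightarrow> real"
  assumes "d \<ge> 1" and "is_form d p"
  defines "f \<equiv> eval_mpoly p"
  shows
    "(\<forall>v. local_minimum_on f (cball 0 1) v \<longrightarrow>
        v \<le> 0
      \<and> (v < 0 \<longrightarrow>
          (\<exists>x \<in> sphere 0 1. local_minimizer_on f (cball 0 1) x \<and> f x = v)
          \<and> local_minimum_on f (sphere 0 1) v)
      \<and> (v = 0 \<longrightarrow>
          {x. local_minimizer_on f (cball 0 1) x \<and> f x = v} = {0}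
          \<or> local_minimum_on f (sphere 0 1) v))
   \<and> (\<forall>v. v \<le> 0 \<and> local_minimum_on f (sphere 0 1) v \<longrightarrow> local_minimum_on f (cball 0 1) v)"
proof -
  have hom: "pos_homogeneous d f"
    unfolding f_def using assms(2) by (rule pos_homogeneous_eval_mpoly)
  show ?thesis
  proof (intro conjI allI impI)
    fix v assume "local_minimum_on f (cball 0 1) v"
    then obtain x where min: "local_minimizer_on f (cball 0 1) x" and v: "f x = v"
      unfolding local_minimum_on_def by blast
    show "v \<le> 0"
      using local_minimizer_cball_nonpos[OF assms(1) hom min] v by simp
    {
      assume "v < 0"
      then have x: "x \<in> sphere 0 1"
        using local_minimizer_cball_neg_in_sphere[OF assms(1) hom min] v by simp
      then show "\<exists>x \<in> sphere 0 1. local_minimizer_on f (cball 0 1) x \<and> f x = v"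
        using min v by blast
      show "local_minimum_on f (sphere 0 1) v"
        using local_minimizer_on_subset[OF min sphere_cball x] v
        unfolding local_minimum_on_def by blast
    }
    {
      assume "v = 0"
      show "{x. local_minimizer_on f (cball 0 1) x \<and> f x = v} = {0}
          \<or> local_minimum_on f (sphere 0 1) v"
      proof (cases "\<exists>y. y \<noteq> 0 \<and> local_minimizer_on f (cball 0 1) y \<and> f y = 0")
        case True
        then obtain y where "y \<noteq> 0" "local_minimizer_on f (cball 0 1) y" "f y = 0"
          by blast
        then have "local_minimizer_on f (sphere 0 1) (sgn y)" "f (sgn y) = v"
          using local_minimizer_sphere_sgn[OF hom] \<open>v = 0\<close> by auto
        then show ?thesis
          unfolding local_minimum_on_def by blast
      next
        \<comment> \<open>The set of minimizers contains \<open>x\<close>, so it is \<open>{0}\<close> rather than empty.\<close>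
        case False
        then have "{x. local_minimizer_on f (cball 0 1) x \<and> f x = v} = {0}"
          using min v \<open>v = 0\<close> by auto
        then show ?thesis ..
      qed
    }
  next
    fix v assume "v \<le> 0 \<and> local_minimum_on f (sphere 0 1) v"
    then obtain x where "local_minimizer_on f (sphere 0 1) x" "f x \<le> 0" "f x = v"
      unfolding local_minimum_on_def by blast
    then show "local_minimum_on f (cball 0 1) v"
      using local_minimizer_sphere_imp_cball[OF hom]
      unfolding local_minimum_on_def by blast
  qed
qed

end
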